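(* Let $\beta=\frac{1+\sqrt5}{2}$. Then $S_\beta(2)=0$, $S_\beta(4)=[(0001)^\infty]_\beta$, $S_\beta(6)=[(00(01)^2)^\infty]_\beta$, and $$S_\beta(p)=\begin{cases}[(0(01)^m)^\infty]_\beta, & p=2m+1,\ m\ge 0,\\ [(001(01)^{m-2}001(01)^m)^\infty]_\beta, & p=4m+2,\ m\ge 2,\\ [(001(01)^{m-1}001(01)^m)^\infty]_\beta, & p=4m+4,\ m\ge 1,\end{cases}$$ where $m$ denotes an integer.
   Context: For $\beta\in(1,2]$ let $T_\beta:[0,1)\to[0,1)$, $T_\beta(x)=\beta x \pmod 1$. For $t\in[0,1)$ the survivor set is $K_\beta(t)=\{x\in[0,1): T_\beta^n(x)\ge t \text{ for all } n\ge 0\}$. A point $x$ has smallest period $p$ if $T_\beta^p(x)=x$ and $T_\beta^j(x)\ne x$ for all $1\le j<p$. For a positive integer $p$, $$S_\beta(p)=\sup\{t\in[0,1): K_\beta(t)\text{ contains a point of smallest period } p\},$$ with the convention that the supremum of the empty set is $0$. For a sequence $(x_i)_{i\ge1}\in\{0,1\}^{\mathbb N}$ write $[(x_1x_2x_3\cdots)]_\beta=\sum_{i\ge1}x_i\beta^{-i}$. For a finite word $w$ over $\{0,1\}$, $w^k$ is the $k$-fold concatenation of $w$ with itself ($w^0$ is the empty word) and $w^\infty$ is the infinite periodic sequence $www\cdots$. *)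

theory Defs
  imports Complex_Main "HOL-Library.Stream"
begin

text \<open>All notions are total in \<open>\<beta>\<close>; they are meant for \<open>1 < \<beta> \<le> 2\<close>. The map is likewise meant on
  \<open>[0,1)\<close>, which it maps into itself.\<close>

definition beta_map :: "real \<Rightarrow> real \<Rightarrow> real" where
  "beta_map \<beta> x = frac (\<beta> * x)"

definition survivor_set :: "real \<Rightarrow> real \<Rightarrow> real set" where
  "survivor_set \<beta> t = {x \<in> {0..<1}. \<forall>n. (beta_map \<beta> ^^ n) x \<ge> t}"

definition has_smallest_period :: "real \<Rightarrow> nat \<Rightarrow> real \<Rightarrow> bool" where
  "has_smallest_period \<beta> p x \<longleftrightarrow>
     x \<in> {0..<1} \<and> 0 < p \<and> (beta_map \<beta> ^^ p) x = x \<and>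
     (\<forall>j. 1 \<le> j \<and> j < p \<longrightarrow> (beta_map \<beta> ^^ j) x \<noteq> x)"

definition period_thresholds :: "real \<Rightarrow> nat \<Rightarrow> real set" where
  "period_thresholds \<beta> p =
     {t \<in> {0..<1}. \<exists>x \<in> survivor_set \<beta> t. has_smallest_period \<beta> p x}"

text \<open>The supremum of the empty set is \<open>0\<close> by convention; the library leaves \<open>Sup {}\<close> on the
  reals unspecified, hence the case distinction.\<close>

definition S_beta :: "real \<Rightarrow> nat \<Rightarrow> real" where
  "S_beta \<beta> p =
     (if period_thresholds \<beta> p = {} then 0 else Sup (period_thresholds \<beta> p))"

text \<open>Streams are indexed from \<open>0\<close>, so the \<open>i\<close>-th digit \<open>x\<^sub>i\<close> (\<open>i \<ge> 1\<close>) of a sequence is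
  \<open>x !! (i - 1)\<close>.\<close>

definition beta_value :: "real \<Rightarrow> nat stream \<Rightarrow> real" where
  "beta_value \<beta> x = (\<Sum>i. real (x !! i) / \<beta> ^ (i + 1))"

definition word_power :: "'a list \<Rightarrow> nat \<Rightarrow> 'a list" where
  "word_power w k = concat (replicate k w)"

end

theory Submission imports Defs begin

text \<open>A periodic orbit survives a threshold exactly if its minimum does, so \<open>S_beta \<beta> p\<close> is the
  largest minimum among the orbits of smallest period \<open>p\<close>, if there are any
  (\<open>S_beta_eqI\<close>). For the golden mean \<open>phi\<close> with \<open>rho = 1 / phi\<close>, a digit 1 is always followed
  by a digit 0. A periodic orbit that stays at or above \<open>rho ^ 3\<close> moreover avoids 000, hence
  its expansion is, up to a shift, a product of the blocks 001 and 01. It cannot consist of blocks 01 alone, because \<open>(01)\<^sup>\<infinity>\<close>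
  would have the value \<open>rho\<close>, whose first digit is 1.

  Let \<open>y = rho - x\<close> be the distance of a point below this forbidden value. If a block 001 begins
  at distance \<open>y\<close>, is followed by \<open>n\<close> blocks 01, and the next 001 begins at distance \<open>y'\<close>, then
  \<open>y = rho ^ 3 + rho ^ (2 * n + 3) * y'\<close>; between the two the orbit does not fall below \<open>rho ^ 2\<close>
  (\<open>return_001\<close>, \<open>next_start_001\<close>). The minimum of the orbit is therefore attained where a 001
  begins, and maximizing it means to minimize the largest such \<open>y\<close>. Since \<open>y'\<close> stays in
  \<open>(rho ^ 3, rho ^ 2]\<close>, a shorter gap \<open>2 * n + 3\<close> always gives a larger \<open>y\<close>
  (\<open>gap_lower_bound\<close>), so that the shortest gap should be as long as possible.

  The gaps are odd and add up to the period. For an odd period above 1 a single gap is best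
  (\<open>S_one_gap\<close>); period 1 belongs to the fixed point 0. For an even period there are at least two; two equal gaps would halve the period,
  so the best choice is a pair of gaps that differ by as little as possible, by 2 or 4 according to
  the period modulo 4 (\<open>S_two_gaps\<close>). The periods 2, 4 and 6 are too short for such a pair: no
  orbit has smallest period 2, and for 4 and 6 the orbits cannot avoid 000. The same recursion for
  \<open>y\<close> holds for the values of the periodic expansions (\<open>beta_value_gap\<close>), which identifies the
  optimal minima with the stated values.\<close>

section \<open>Thresholds attained on an orbit\<close>

lemma beta_map_funpow_range:
  assumes "x \<in> {0..<1}"
  shows "(beta_map \<beta> ^^ n) x \<in> {0..<1}"
  using assms by (cases n) (auto simp: beta_map_def frac_lt_1)

lemma has_smallest_period_funpow:
  assumes "has_smallest_period \<beta> p x"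
  shows "has_smallest_period \<beta> p ((beta_map \<beta> ^^ n) x)"
proof -
  let ?T = "beta_map \<beta>"
  have x: "x \<in> {0..<1}" and p: "0 < p" and per: "(?T ^^ p) x = x"
    and least: "\<And>j. 1 \<le> j \<Longrightarrow> j < p \<Longrightarrow> (?T ^^ j) x \<noteq> x"
    using assms by (auto simp: has_smallest_period_def)
  have "(?T ^^ j) ((?T ^^ n) x) \<noteq> (?T ^^ n) x" if j: "1 \<le> j" "j < p" for j
  proof
    assume "(?T ^^ j) ((?T ^^ n) x) = (?T ^^ n) x"
    \<comment> \<open>Moving on to time \<open>p * n\<close>, a multiple of the period, carries the coincidence back to \<open>x\<close>.\<close>
    then have "(?T ^^ ((p - 1) * n)) ((?T ^^ (j + n)) x) = (?T ^^ ((p - 1) * n)) ((?T ^^ n) x)"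
      by (simp add: funpow_add)
    then have "(?T ^^ ((p - 1) * n + (j + n))) x = (?T ^^ ((p - 1) * n + n)) x"
      by (simp only: funpow_add comp_apply)
    moreover have "(p - 1) * n + n = p * n"
      using p by (cases p) auto
    ultimately have "(?T ^^ (j + p * n)) x = (?T ^^ (p * n)) x"
      by (simp add: algebra_simps)
    moreover have "(?T ^^ ((j + p * n) mod p)) x = (?T ^^ (j + p * n)) x"
      "(?T ^^ ((p * n) mod p)) x = (?T ^^ (p * n)) x"
      by (rule funpow_mod_eq[OF per])+
    ultimately show False
      using least[OF j] j by simp
  qed
  moreover have "(?T ^^ p) ((?T ^^ n) x) = (?T ^^ n) x"
    using per by (metis add.commute comp_apply funpow_add)
  ultimately show ?thesis
    using beta_map_funpow_range[OF x] p by (auto simp: has_smallest_period_def)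
qed

text \<open>A periodic orbit survives exactly up to its least point, so \<open>S_beta\<close> is the greatest
  least point of an orbit of smallest period \<open>p\<close>. A point strictly below the rest of its cycle
  returns for the first time after \<open>p\<close> steps, which settles its smallest period at once.\<close>

lemma S_beta_eqI:
  assumes V: "V \<in> {0..<1}" and p: "0 < p" and per: "(beta_map \<beta> ^^ p) V = V"
    and above: "\<And>j. 1 \<le> j \<Longrightarrow> j < p \<Longrightarrow> V < (beta_map \<beta> ^^ j) V"
    and best: "\<And>x. has_smallest_period \<beta> p x \<Longrightarrow> \<exists>n. (beta_map \<beta> ^^ n) x \<le> V"
  shows "S_beta \<beta> p = V"
proof -
  have "V \<le> (beta_map \<beta> ^^ n) V" for n
  proof -
    have "V \<le> (beta_map \<beta> ^^ (n mod p)) V"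
      using above[of "n mod p"] p by (cases "n mod p = 0") (auto simp: order_less_imp_le)
    then show ?thesis
      by (simp only: funpow_mod_eq[OF per])
  qed
  moreover have "has_smallest_period \<beta> p V"
    using V p per above by (force simp: has_smallest_period_def)
  ultimately have mem: "V \<in> period_thresholds \<beta> p"
    using V by (auto simp: period_thresholds_def survivor_set_def)
  have "t \<le> V" if t: "t \<in> period_thresholds \<beta> p" for t
  proof -
    obtain x where x: "has_smallest_period \<beta> p x" "\<And>n. t \<le> (beta_map \<beta> ^^ n) x"
      using t by (auto simp: period_thresholds_def survivor_set_def)
    obtain n where "(beta_map \<beta> ^^ n) x \<le> V"
      using best[OF x(1)] by blast
    with x(2)[of n] show ?thesis by linarith
  qed
  then have "Sup (period_thresholds \<beta> p) = V"
    using mem by (intro cSup_eq_maximum) auto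
  then show ?thesis
    using mem by (auto simp: S_beta_def)
qed

section \<open>The golden mean map\<close>

definition phi :: real where "phi = (1 + sqrt 5) / 2"

definition rho :: real where "rho = phi - 1"

abbreviation T :: "real \<Rightarrow> real" where "T \<equiv> beta_map phi"

lemma rho_square: "rho ^ 2 = 1 - rho"
proof -
  have "sqrt 5 ^ 2 = (5 :: real)" by simp
  then show ?thesis
    unfolding rho_def phi_def by (simp add: power2_eq_square field_simps)
qed

lemma rho_bounds: "309 / 500 < rho" "rho < 6181 / 10000"
proof -
  have "559 / 250 < sqrt (5 :: real)"
    by (rule real_less_rsqrt) (simp add: power2_eq_square)
  moreover have "sqrt (5 :: real) < 11181 / 5000"
    by (rule real_less_lsqrt) (simp_all add: power2_eq_square)
  ultimately show "309 / 500 < rho" "rho < 6181 / 10000"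
    by (simp_all add: rho_def phi_def)
qed

lemma rho_cube: "rho ^ 3 = 2 * rho - 1"
proof -
  have "rho ^ 3 = rho * rho ^ 2" by (simp add: power3_eq_cube power2_eq_square)
  also have "\<dots> = 2 * rho - 1"
    unfolding rho_square using rho_square by (simp add: algebra_simps power2_eq_square)
  finally show ?thesis .
qed

lemma rho_mult_self: "rho * rho = 1 - rho" "rho * (rho * z) = z - rho * z"
proof -
  show "rho * rho = 1 - rho" using rho_square by (simp add: power2_eq_square)
  then have "(rho * rho) * z = (1 - rho) * z" by simp
  then show "rho * (rho * z) = z - rho * z" by (simp add: algebra_simps)
qed

lemma phi_eq: "phi = 1 + rho"
  by (simp add: rho_def)

lemma rho_phi: "rho * phi = 1"
  by (simp add: phi_eq algebra_simps rho_mult_self)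

lemma T_below:
  assumes "0 \<le> z" "z < rho"
  shows "T z = phi * z"
proof -
  have "0 < phi" using rho_bounds by (simp add: phi_eq)
  then have "0 \<le> phi * z" "phi * z < phi * rho"
    using assms by simp_all
  then show ?thesis
    using rho_phi by (simp add: beta_map_def frac_eq mult.commute)
qed

lemma T_above:
  assumes "rho \<le> z" "z < 1"
  shows "T z = phi * z - 1"
proof -
  have "0 < phi" "phi < 2" using rho_bounds by (simp_all add: phi_eq)
  then have "phi * rho \<le> phi * z" "phi * z < phi * 1"
    using assms by simp_all
  with \<open>phi < 2\<close> have "floor (phi * z) = 1"
    using rho_phi by (simp add: mult.commute[of phi rho] floor_eq_iff)
  then show ?thesis by (simp add: beta_map_def frac_def)
qed

section \<open>The two blocks of an orbit\<close>

text \<open>The point \<open>rho\<close> would be the value of the forbidden sequence \<open>(01)\<^sup>\<infinity>\<close>. In the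
  distance \<open>y\<close> below \<open>rho\<close>, the block \<open>01\<close> acts on \<open>(0, rho ^ 3]\<close> as multiplication by
  \<open>phi ^ 2\<close>, and the block \<open>001\<close> acts on \<open>(rho ^ 3, rho ^ 2]\<close> as \<open>y \<mapsto> phi ^ 3 * y - 1\<close>.
  The lemmas are stated for the inverse branches, in terms of the distance \<open>y\<close> after the block.\<close>

lemma block_01:
  assumes "0 < y" "y \<le> rho"
  shows "rho ^ 2 \<le> rho - rho ^ 2 * y"
    and "T (rho - rho ^ 2 * y) = 1 - rho * y"
    and "rho ^ 2 \<le> 1 - rho * y"
    and "T (T (rho - rho ^ 2 * y)) = rho - y"
proof -
  have *: "rho * y \<le> 1 - rho" "0 < rho * y" "0 < rho ^ 2 * y" "rho ^ 2 * y \<le> 2 * rho - 1"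
    using assms rho_bounds mult_left_mono[of y rho rho] mult_left_mono[of y rho "rho ^ 2"]
    by (auto simp: rho_mult_self rho_square algebra_simps)
  show 1: "rho ^ 2 \<le> rho - rho ^ 2 * y"
    using * unfolding rho_square by linarith
  show 3: "rho ^ 2 \<le> 1 - rho * y"
    using * rho_bounds unfolding rho_square by linarith
  have "T (rho - rho ^ 2 * y) = phi * (rho - rho ^ 2 * y)"
    using * rho_bounds by (intro T_below) linarith+
  also have "\<dots> = 1 - rho * y"
    by (simp add: phi_eq rho_square algebra_simps rho_mult_self)
  finally show 2: "T (rho - rho ^ 2 * y) = 1 - rho * y" .
  have "T (1 - rho * y) = phi * (1 - rho * y) - 1"
    using * rho_bounds by (intro T_above) linarith+
  also have "\<dots> = rho - y"
    by (simp add: phi_eq algebra_simps rho_mult_self)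
  finally show "T (T (rho - rho ^ 2 * y)) = rho - y"
    unfolding 2 .
qed

text \<open>The map removes the first 0 of 001, which leaves a block 01.\<close>

lemma block_001:
  assumes "0 < y" "y \<le> rho"
  shows "rho ^ 2 \<le> T (rho - (rho ^ 3 + rho ^ 3 * y))"
    and "rho ^ 2 \<le> T (T (rho - (rho ^ 3 + rho ^ 3 * y)))"
    and "T (T (T (rho - (rho ^ 3 + rho ^ 3 * y)))) = rho - y"
proof -
  let ?x = "rho - (rho ^ 3 + rho ^ 3 * y)"
  have *: "0 < rho ^ 3 * y" "rho ^ 3 * y \<le> 2 - 3 * rho"
    using assms rho_bounds mult_left_mono[of y rho "rho ^ 3"]
    by (auto simp: rho_mult_self rho_cube algebra_simps)
  have "T ?x = phi * ?x"
    using * rho_bounds rho_cube by (intro T_below) linarith+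
  also have "\<dots> = rho - rho ^ 2 * y"
    by (simp add: phi_eq rho_square rho_cube algebra_simps rho_mult_self)
  finally have 1: "T ?x = rho - rho ^ 2 * y" .
  show "rho ^ 2 \<le> T ?x" "rho ^ 2 \<le> T (T ?x)" "T (T (T ?x)) = rho - y"
    unfolding 1 using block_01[OF assms] by simp_all
qed

text \<open>Read backwards, the blocks contract distances, so that each of them begins at distance at most
  \<open>rho ^ 3 = rho - rho ^ 2\<close>.\<close>

lemma run_01:
  assumes "0 < y" "y \<le> rho"
  shows "(T ^^ (2 * n)) (rho - rho ^ (2 * n) * y) = rho - y"
    and "j < 2 * n \<Longrightarrow> rho ^ 2 \<le> (T ^^ j) (rho - rho ^ (2 * n) * y)"
proof (induction n arbitrary: j)
  case (Suc n)
  let ?y = "rho ^ (2 * n) * y"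
  have "rho ^ (2 * n) * y \<le> 1 * y"
    using assms rho_bounds by (intro mult_right_mono power_le_one) auto
  then have y: "0 < ?y" "?y \<le> rho"
    using assms(1) rho_bounds order.trans[OF _ assms(2)] by auto
  have split: "rho ^ (2 * Suc n) * y = rho ^ 2 * ?y"
    by (simp add: power2_eq_square)
  have two: "(T ^^ Suc (Suc k)) (rho - rho ^ (2 * Suc n) * y) = (T ^^ k) (rho - ?y)" for k
    unfolding split funpow_Suc_right comp_apply block_01(4)[OF y] ..
  {
    case 1
    show ?case using two[of "2 * n"] Suc.IH(1) by simp
  next
    case 2
    consider "j = 0" | "j = 1" | k where "j = Suc (Suc k)"
      by (metis One_nat_def nat.exhaust)
    then show ?case
    proof cases
      case 3
      then show ?thesis using two[of k] Suc.IH(2)[of k] 2 by simp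
    qed (simp_all add: split block_01(1-3)[OF y] del: power_Suc mult_Suc_right)
  }
qed auto

text \<open>The points of \<open>[rho ^ 3, rho ^ 2)\<close> are those at which a block 001 begins. The lemma
  describes the passage through 001 and \<open>n\<close> blocks 01. It takes an odd time, and since it meets no
  point below \<open>rho ^ 2\<close> on the way, its end is the first return if another 001 begins there.\<close>

lemma return_001:
  assumes "0 < y'" "y' \<le> rho" and y: "y = rho ^ 3 + rho ^ (2 * n + 3) * y'"
  shows "(T ^^ (2 * n + 3)) (rho - y) = rho - y'"
    and "1 \<le> j \<Longrightarrow> j < 2 * n + 3 \<Longrightarrow> rho ^ 2 \<le> (T ^^ j) (rho - y)"
proof -
  let ?y = "rho ^ (2 * n) * y'"
  have "rho ^ (2 * n) * y' \<le> 1 * y'"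
    using assms rho_bounds by (intro mult_right_mono power_le_one) auto
  then have y0: "0 < ?y" "?y \<le> rho"
    using assms(1) rho_bounds order.trans[OF _ assms(2)] by auto
  have y: "y = rho ^ 3 + rho ^ 3 * ?y"
    unfolding y by (simp add: power_add)
  have three: "(T ^^ (k + 3)) (rho - y) = (T ^^ k) (rho - ?y)" for k
  proof -
    have "(T ^^ (k + 3)) u = (T ^^ k) (T (T (T u)))" for u
      by (simp only: funpow_add comp_apply) (simp add: numeral_3_eq_3)
    then show ?thesis unfolding y using block_001(3)[OF y0] by simp
  qed
  show "(T ^^ (2 * n + 3)) (rho - y) = rho - y'"
    unfolding three by (rule run_01(1)[OF assms(1,2)])
  show "rho ^ 2 \<le> (T ^^ j) (rho - y)" if j: "1 \<le> j" "j < 2 * n + 3"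
  proof -
    consider "j = 1" | "j = 2" | k where "j = k + 3"
      using j by (metis One_nat_def Suc_1 add.commute le_Suc_eq le_add_diff_inverse
          not_less_eq_eq numeral_3_eq_3 order.antisym)
    then show ?thesis
    proof cases
      case 3
      then show ?thesis using run_01(2)[OF assms(1,2), of k n] j three[of k] by simp
    qed (use block_001(1,2)[OF y0] y in \<open>auto simp: numeral_2_eq_2\<close>)
  qed
qed

text \<open>A point strictly below \<open>rho\<close> is driven away from it by the factor \<open>phi ^ 2\<close> per block;
  hence a run of blocks 01 is finite. It stops at the least \<open>n\<close> for which the distance exceeds
  \<open>rho ^ 3\<close>, and the previous step bounds that distance by \<open>phi ^ 2 * rho ^ 3 = rho\<close>.\<close>

lemma escape_01:
  assumes "0 < y" "y \<le> rho"
  obtains n y' where "y = rho ^ (2 * n) * y'" "rho ^ 3 < y'" "y' \<le> rho"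
proof -
  define P where "P n \<longleftrightarrow> rho ^ 3 * rho ^ (2 * n) < y" for n
  have r: "0 < rho" "rho < 1" using rho_bounds by auto
  obtain N where N: "rho ^ N < y"
    using real_arch_pow_inv[OF assms(1) r(2)] by blast
  have "rho ^ 3 * rho ^ (2 * N) = rho ^ (3 + 2 * N)" by (simp add: power_add)
  also have "\<dots> \<le> rho ^ N" using r by (intro power_decreasing) auto
  finally have "P N" using N by (simp add: P_def)
  define n where "n = (LEAST n. P n)"
  have n: "P n" unfolding n_def using \<open>P N\<close> by (rule LeastI)
  have le: "y \<le> rho * rho ^ (2 * n)"
  proof (cases n)
    case 0
    then show ?thesis using assms by simp
  next
    case (Suc k)
    then have "\<not> P k" unfolding n_def by (intro not_less_Least) simp
    then have "y \<le> rho ^ 3 * rho ^ (2 * k)" by (simp add: P_def)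
    then show ?thesis using Suc by (simp add: power3_eq_cube algebra_simps)
  qed
  show ?thesis
  proof
    show "y = rho ^ (2 * n) * (y / rho ^ (2 * n))" using r by simp
    show "rho ^ 3 < y / rho ^ (2 * n)" "y / rho ^ (2 * n) \<le> rho"
      using n le r by (auto simp: P_def field_simps)
  qed
qed

section \<open>Gaps between blocks 001 in a periodic orbit\<close>

text \<open>The clause \<open>T u < rho\<close> of the second case says that no two digits 1 are adjacent.\<close>

lemma T_digit:
  assumes "u \<in> {0..<1}"
  obtains "u < rho" "u = rho * T u" | "rho \<le> u" "u = rho * (1 + T u)" "T u < rho"
proof (cases "u < rho")
  case True
  then show ?thesis
    using that(1) assms T_below[of u] rho_phi by (simp flip: mult.assoc)
next
  case False
  then have T: "T u = phi * u - 1" using assms T_above[of u] by simp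
  moreover have "phi * u < phi * 1"
    using assms rho_bounds by (intro mult_strict_left_mono) (auto simp: phi_eq)
  ultimately have "T u < rho" by (simp add: rho_def)
  moreover have "u = rho * (1 + T u)"
    unfolding T using rho_phi by (simp flip: mult.assoc)
  ultimately show ?thesis
    using that(2) False by simp
qed

lemma T_digit_le: "u \<in> {0..<1} \<Longrightarrow> u \<le> rho * (1 + T u)"
  by (erule T_digit) (use rho_bounds in \<open>simp_all add: distrib_left\<close>)

lemma ex_start_001:
  assumes x: "x \<in> {0..<1}" and high: "\<And>n. rho ^ 3 \<le> (T ^^ n) x"
  obtains n y where "(T ^^ n) x = rho - y" "rho ^ 3 < y" "y \<le> rho ^ 2"
proof -
  obtain m where m: "(T ^^ m) x < rho"
  proof (cases "x < rho")
    case True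
    then show ?thesis using that[of 0] by simp
  next
    case False
    then show ?thesis using that[of 1] T_digit[OF x] by auto
  qed
  have "0 < rho - (T ^^ m) x" "rho - (T ^^ m) x \<le> rho"
    using m beta_map_funpow_range[OF x, of m phi] by auto
  then obtain n y where y: "rho - (T ^^ m) x = rho ^ (2 * n) * y" "rho ^ 3 < y" "y \<le> rho"
    by (rule escape_01)
  have "(T ^^ m) x = rho - rho ^ (2 * n) * y" using y(1) by simp
  moreover have "0 < y" using y(2) rho_bounds rho_cube by linarith
  ultimately have n: "(T ^^ (2 * n + m)) x = rho - y"
    using run_01(1)[of y n] y(3) by (simp add: funpow_add)
  moreover have "y \<le> rho ^ 2"
    using high[of "2 * n + m"] rho_cube rho_square unfolding n by linarith
  ultimately show ?thesis using that y(2) by blast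
qed

text \<open>The next start of a block 001 comes no later than time \<open>p\<close>: before it the orbit does not fall
  below \<open>rho ^ 2\<close>, where the point at time \<open>p\<close> lies.\<close>

lemma next_start_001:
  assumes high: "\<And>n. rho ^ 3 \<le> (T ^^ n) x"
    and p: "(T ^^ p) x < rho ^ 2" and k: "k < p"
    and y: "(T ^^ k) x = rho - y" "rho ^ 3 < y" "y \<le> rho ^ 2"
  obtains n y' where "k + (2 * n + 3) \<le> p" "y = rho ^ 3 + rho ^ (2 * n + 3) * y'"
    "(T ^^ (k + (2 * n + 3))) x = rho - y'" "rho ^ 3 < y'" "y' \<le> rho ^ 2"
proof -
  let ?z = "(y - rho ^ 3) / rho ^ 3"
  have pos: "0 < rho ^ 3" using rho_bounds by simp
  have "y - rho ^ 3 \<le> 2 - 3 * rho"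
    using y(3) rho_square rho_cube by linarith
  also have "\<dots> = rho * rho ^ 3"
    by (simp add: rho_cube algebra_simps rho_mult_self)
  finally have "0 < ?z" "?z \<le> rho"
    using y(2) pos by (simp_all add: pos_divide_le_eq)
  then obtain n y' where n: "?z = rho ^ (2 * n) * y'" "rho ^ 3 < y'" "y' \<le> rho"
    by (rule escape_01)
  have "y - rho ^ 3 = rho ^ 3 * ?z" using pos by simp
  then have eq: "y = rho ^ 3 + rho ^ (2 * n + 3) * y'"
    unfolding n(1) by (simp add: power_add algebra_simps)
  have "0 < y'" using n(2) pos by linarith
  note ret = return_001[OF this n(3) eq, folded y(1)]
  have shift: "(T ^^ (k + j)) x = (T ^^ j) ((T ^^ k) x)" for j
    by (simp only: add.commute[of k j] funpow_add comp_apply)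
  have ret': "(T ^^ (k + (2 * n + 3))) x = rho - y'"
    unfolding shift by (rule ret(1))
  moreover have "y' \<le> rho ^ 2"
    using high[of "k + (2 * n + 3)"] rho_cube rho_square unfolding ret' by linarith
  moreover have "k + (2 * n + 3) \<le> p"
  proof (rule ccontr)
    assume "\<not> k + (2 * n + 3) \<le> p"
    then have "rho ^ 2 \<le> (T ^^ (p - k)) ((T ^^ k) x)"
      using k by (intro ret(2)) auto
    then show False
      using p k shift[of "p - k"] by simp
  qed
  ultimately show ?thesis using that eq n(2) by blast
qed

lemma start_001_of_period:
  assumes per: "has_smallest_period phi p x" and high: "\<And>n. rho ^ 3 \<le> (T ^^ n) x"
  obtains m y where "(T ^^ m) x = rho - y" "rho ^ 3 < y" "y \<le> rho ^ 2"
    "has_smallest_period phi p (rho - y)" "(T ^^ p) (rho - y) < rho ^ 2"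
proof -
  have "x \<in> {0..<1}" using per by (simp add: has_smallest_period_def)
  then obtain m y where y: "(T ^^ m) x = rho - y" "rho ^ 3 < y" "y \<le> rho ^ 2"
    using ex_start_001 high by blast
  have "has_smallest_period phi p (rho - y)"
    using has_smallest_period_funpow[OF per, of m] y(1) by simp
  moreover from this have "(T ^^ p) (rho - y) < rho ^ 2"
    using y(2) rho_cube rho_square by (simp add: has_smallest_period_def)
  ultimately show ?thesis using that y by blast
qed

text \<open>The distances at the starts of blocks 001 lie in \<open>(rho ^ 3, rho ^ 2]\<close> and thus differ by a factor
  less than \<open>phi\<close>. Shortening the gap by a single step already outweighs this.\<close>

lemma gap_lower_bound:
  assumes "y = rho ^ 3 + rho ^ L * y'" "rho ^ 3 < y'" "y \<le> rho ^ 3 + rho ^ K * c" "c \<le> rho ^ 2"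
  shows "K \<le> L"
proof (rule ccontr)
  assume "\<not> K \<le> L"
  have r: "0 < rho" "rho < 1" using rho_bounds by auto
  have "rho ^ K * c \<le> rho ^ K * rho ^ 2" using assms(4) r by (intro mult_left_mono) auto
  also have "\<dots> = rho ^ (K + 2)" by (simp only: power_add)
  also have "\<dots> \<le> rho ^ (L + 3)" using r \<open>\<not> K \<le> L\<close> by (intro power_decreasing) auto
  also have "\<dots> = rho ^ L * rho ^ 3" by (simp add: power_add)
  also have "\<dots> < rho ^ L * y'" using assms(2) r by (intro mult_strict_left_mono) auto
  finally show False using assms(1,3) by linarith
qed

text \<open>The relations between the distances at consecutive blocks \<open>001\<close> determine a cycle,
  because going once around it is a contraction.\<close>

lemma gap_cycle_unique:
  assumes "y = rho ^ 3 + rho ^ K * y'" "y' = rho ^ 3 + rho ^ M * y"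
    and "z = rho ^ 3 + rho ^ K * z'" "z' = rho ^ 3 + rho ^ M * z" and "0 < K"
  shows "y = z"
proof -
  have "y - z = rho ^ K * (y' - z')"
    using assms(1,3) by (simp add: right_diff_distrib)
  also have "y' - z' = rho ^ M * (y - z)"
    using assms(2,4) by (simp add: right_diff_distrib)
  finally have "(1 - rho ^ (K + M)) * (y - z) = 0"
    by (simp add: power_add left_diff_distrib)
  moreover have "rho ^ (K + M) < 1"
    using rho_bounds \<open>0 < K\<close> by (cases K) (auto intro!: power_Suc_less_one simp del: power_Suc)
  ultimately show ?thesis by simp
qed

text \<open>The relations for two gaps are solved by the distance of a point at which a block 001 begins,
  as required of a candidate for the minimum.\<close>

lemma gap_cycle_bounds:
  assumes y: "y = rho ^ 3 + rho ^ K * y'" "y' = rho ^ 3 + rho ^ M * y" and "3 \<le> K" "3 \<le> M"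
  shows "rho ^ 3 < y" "y < rho ^ 2"
proof -
  have r: "0 < rho" "rho < 1" using rho_bounds by auto
  have six: "rho ^ 3 * rho ^ 3 = 5 - 8 * rho"
    by (simp add: rho_cube algebra_simps rho_mult_self)
  have KM: "rho ^ K \<le> rho ^ 3" "rho ^ M \<le> rho ^ 3"
    using r assms(3,4) by (auto intro: power_decreasing)
  define c where "c = rho ^ K * rho ^ M"
  define d where "d = rho ^ K * rho ^ 3"
  have c: "0 < c" "c \<le> 5 - 8 * rho" and d: "0 < d" "d \<le> 5 - 8 * rho"
    using mult_mono[OF KM] mult_mono[OF KM(1) order_refl[of "rho ^ 3"]] r
    by (simp_all only: c_def d_def six) simp_all
  have eq: "y = rho ^ 3 + d + c * y"
    using y by (simp add: c_def d_def algebra_simps)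
  have "y - c * y = rho ^ 3 + d" using eq by linarith
  then have "(1 - c) * y = rho ^ 3 + d" by (simp add: left_diff_distrib)
  then have "0 < (1 - c) * y" using d(1) r by (simp add: add_pos_pos)
  moreover have "0 < 1 - c" using c rho_bounds by linarith
  ultimately have "0 < y" by (simp add: zero_less_mult_iff)
  then have "0 < c * y" "c * y \<le> (5 - 8 * rho) * y" "(5 - 8 * rho) * y \<le> 1 / 10 * y"
    using c rho_bounds by (auto intro!: mult_right_mono)
  then show "rho ^ 3 < y" "y < rho ^ 2"
    using eq d rho_bounds rho_cube rho_square by linarith+
qed

section \<open>Optimal cycles\<close>

text \<open>In an orbit with a larger minimum each gap would have to be at least as long as that of the
  candidate, hence equal to the period; but this is the candidate.\<close>

lemma S_one_gap:
  assumes Y: "Y = rho ^ 3 + rho ^ (2 * n + 3) * Y"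
  shows "S_beta phi (2 * n + 3) = rho - Y"
proof (rule S_beta_eqI)
  have bd: "rho ^ 3 < Y" "Y < rho ^ 2"
    using gap_cycle_bounds[OF Y Y] by simp_all
  have Y0: "0 < Y" "Y \<le> rho"
    using bd rho_bounds rho_cube rho_square by linarith+
  note ret = return_001[OF Y0 Y]
  show "rho - Y \<in> {0..<1}" using Y0 rho_bounds by auto
  show "(T ^^ (2 * n + 3)) (rho - Y) = rho - Y" by (rule ret(1))
  show "rho - Y < (T ^^ j) (rho - Y)" if "1 \<le> j" "j < 2 * n + 3" for j
    using ret(2)[OF that] bd rho_cube rho_square by linarith
  fix x assume per: "has_smallest_period phi (2 * n + 3) x"
  show "\<exists>m. (T ^^ m) x \<le> rho - Y"
  proof (rule ccontr)
    assume "\<not> ?thesis"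
    then have low: "rho - Y < (T ^^ m) x" for m by (simp add: not_le)
    then have "rho ^ 3 \<le> (T ^^ m) x" for m
      using bd(2) rho_cube rho_square low[of m] by linarith
    then obtain m y where y: "(T ^^ m) x = rho - y" "rho ^ 3 < y" "y \<le> rho ^ 2"
      "has_smallest_period phi (2 * n + 3) (rho - y)" "(T ^^ (2 * n + 3)) (rho - y) < rho ^ 2"
      using start_001_of_period[OF per] by blast
    have low': "rho - Y < (T ^^ k) (rho - y)" for k
      using low[of "k + m"] y(1) by (simp add: funpow_add)
    then have high: "rho ^ 3 \<le> (T ^^ k) (rho - y)" for k
      using bd(2) rho_cube rho_square low'[of k] by linarith
    obtain l y' where l: "0 + (2 * l + 3) \<le> 2 * n + 3" "y = rho ^ 3 + rho ^ (2 * l + 3) * y'"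
      "(T ^^ (0 + (2 * l + 3))) (rho - y) = rho - y'" "rho ^ 3 < y'"
      by (rule next_start_001[OF high y(5), of 0 y]) (use y in auto)
    have "y < Y" using low'[of 0] by simp
    then have "2 * n + 3 \<le> 2 * l + 3"
      using gap_lower_bound[OF l(2,4), of "2 * n + 3" Y] Y bd(2) by linarith
    then have "l = n" using l(1) by simp
    then have "y' = y"
      using l(3) y(4) by (simp add: has_smallest_period_def)
    then have "y = Y"
      using gap_cycle_unique[of y "2 * n + 3" y "2 * n + 3" Y Y] l(2) Y \<open>l = n\<close> by simp
    then show False using \<open>y < Y\<close> by simp
  qed
qed simp

text \<open>In an orbit with a larger minimum the gaps are odd and at least \<open>2 * n + 3\<close>. As the period is
  even, their number is even, and four of them would exceed the period; so there are two. Their sum leaves only the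
  candidate itself, started at either of its two blocks \<open>001\<close>, and possibly two equal gaps, which
  halve the smallest period.\<close>

lemma S_two_gaps:
  assumes Y: "Y = rho ^ 3 + rho ^ (2 * n + 3) * Y'"
    and Y': "Y' = rho ^ 3 + rho ^ (2 * n' + 3) * Y" and n': "n' = n + 1 \<or> n' = n + 2"
    and p: "p = (2 * n + 3) + (2 * n' + 3)"
  shows "S_beta phi p = rho - Y"
proof (rule S_beta_eqI)
  have r: "0 < rho" "rho < 1" using rho_bounds by auto
  have bd: "rho ^ 3 < Y" "Y < rho ^ 2" and bd': "rho ^ 3 < Y'" "Y' < rho ^ 2"
    using gap_cycle_bounds[OF Y Y'] gap_cycle_bounds[OF Y' Y] by simp_all
  have pos: "0 < Y" "Y \<le> rho" "0 < Y'" "Y' \<le> rho"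
    using bd bd' rho_bounds rho_cube rho_square by linarith+
  have "Y' < Y"
  proof (rule ccontr)
    assume "\<not> Y' < Y"
    then have "rho ^ (2 * n + 3) * Y \<le> rho ^ (2 * n + 3) * Y'" using r by simp
    moreover have "rho ^ (2 * n' + 3) * Y < rho ^ (2 * n + 3) * Y"
      using r pos n' by (intro mult_strict_right_mono power_strict_decreasing) auto
    ultimately show False using Y Y' \<open>\<not> Y' < Y\<close> by linarith
  qed
  note ret = return_001[OF pos(3,4) Y] and ret' = return_001[OF pos(1,2) Y']
  have shift: "(T ^^ (2 * n + 3 + j)) (rho - Y) = (T ^^ j) (rho - Y')" for j
    by (simp only: add.commute[of _ j] funpow_add[of j] comp_apply ret(1))
  show "rho - Y \<in> {0..<1}" using pos rho_bounds by auto
  show "0 < p" using p by simp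
  show "(T ^^ p) (rho - Y) = rho - Y" unfolding p shift by (rule ret'(1))
  show "rho - Y < (T ^^ j) (rho - Y)" if j: "1 \<le> j" "j < p" for j
  proof -
    have above: "rho - Y < rho ^ 2" using bd rho_cube rho_square by linarith
    consider "j < 2 * n + 3" | "j = 2 * n + 3" | "2 * n + 3 < j" by linarith
    then show ?thesis
    proof cases
      case 1
      then show ?thesis using ret(2)[of j] j above by linarith
    next
      case 2
      then show ?thesis using ret(1) \<open>Y' < Y\<close> by simp
    next
      case 3
      then have i: "j = 2 * n + 3 + (j - (2 * n + 3))" by simp
      have "rho ^ 2 \<le> (T ^^ (j - (2 * n + 3))) (rho - Y')"
        using 3 j p by (intro ret'(2)) auto
      then show ?thesis using shift[of "j - (2 * n + 3)", folded i] above by simp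
    qed
  qed
  fix x assume per: "has_smallest_period phi p x"
  show "\<exists>m. (T ^^ m) x \<le> rho - Y"
  proof (rule ccontr)
    assume "\<not> ?thesis"
    then have low: "rho - Y < (T ^^ m) x" for m by (simp add: not_le)
    then have "rho ^ 3 \<le> (T ^^ m) x" for m
      using bd(2) rho_cube rho_square low[of m] by linarith
    then obtain m y where y: "(T ^^ m) x = rho - y" "rho ^ 3 < y" "y \<le> rho ^ 2"
      and per_y: "has_smallest_period phi p (rho - y)" and lt: "(T ^^ p) (rho - y) < rho ^ 2"
      using start_001_of_period[OF per] by blast
    have low': "rho - Y < (T ^^ k) (rho - y)" for k
      using low[of "k + m"] y(1) by (simp add: funpow_add)
    then have high: "rho ^ 3 \<le> (T ^^ k) (rho - y)" for k
      using bd(2) rho_cube rho_square low'[of k] by linarith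
    have next_gap: "\<exists>l z'. k + (2 * l + 3) \<le> p \<and> z = rho ^ 3 + rho ^ (2 * l + 3) * z' \<and>
        (T ^^ (k + (2 * l + 3))) (rho - y) = rho - z' \<and> rho ^ 3 < z' \<and> z' \<le> rho ^ 2 \<and> n \<le> l"
      if "k < p" and z: "(T ^^ k) (rho - y) = rho - z" "rho ^ 3 < z" "z \<le> rho ^ 2" for k z
    proof -
      obtain l z' where l: "k + (2 * l + 3) \<le> p" "z = rho ^ 3 + rho ^ (2 * l + 3) * z'"
        "(T ^^ (k + (2 * l + 3))) (rho - y) = rho - z'" "rho ^ 3 < z'" "z' \<le> rho ^ 2"
        by (rule next_start_001[OF high lt \<open>k < p\<close> z])
      have "z < Y" using low'[of k] z(1) by simp
      then have "2 * n + 3 \<le> 2 * l + 3"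
        using gap_lower_bound[OF l(2,4), of "2 * n + 3" Y'] Y bd'(2) by linarith
      then show ?thesis using l by auto
    qed
    obtain l1 y1 where l1: "2 * l1 + 3 \<le> p" "y = rho ^ 3 + rho ^ (2 * l1 + 3) * y1"
      "(T ^^ (2 * l1 + 3)) (rho - y) = rho - y1" "rho ^ 3 < y1" "y1 \<le> rho ^ 2" "n \<le> l1"
      using next_gap[OF \<open>0 < p\<close> _ y(2,3)] unfolding add_0 funpow_0 by blast
    have lt1: "2 * l1 + 3 < p" using l1(1) p by presburger
    then obtain l2 y2 where l2: "2 * l1 + 3 + (2 * l2 + 3) \<le> p"
      "y1 = rho ^ 3 + rho ^ (2 * l2 + 3) * y2"
      "(T ^^ (2 * l1 + 3 + (2 * l2 + 3))) (rho - y) = rho - y2"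
      "rho ^ 3 < y2" "y2 \<le> rho ^ 2" "n \<le> l2"
      using next_gap[OF lt1 l1(3-5)] by blast
    have sum: "2 * l1 + 3 + (2 * l2 + 3) = p"
    proof (rule ccontr)
      assume "2 * l1 + 3 + (2 * l2 + 3) \<noteq> p"
      then have lt2: "2 * l1 + 3 + (2 * l2 + 3) < p" using l2(1) by simp
      obtain l3 y3 where l3: "2 * l1 + 3 + (2 * l2 + 3) + (2 * l3 + 3) \<le> p"
        "(T ^^ (2 * l1 + 3 + (2 * l2 + 3) + (2 * l3 + 3))) (rho - y) = rho - y3"
        "rho ^ 3 < y3" "y3 \<le> rho ^ 2" "n \<le> l3"
        using next_gap[OF lt2 l2(3-5)] by blast
      have lt3: "2 * l1 + 3 + (2 * l2 + 3) + (2 * l3 + 3) < p" using l3(1) p by presburger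
      obtain l4 where
        "2 * l1 + 3 + (2 * l2 + 3) + (2 * l3 + 3) + (2 * l4 + 3) \<le> p" "n \<le> l4"
        using next_gap[OF lt3 l3(2-4)] by blast
      then show False using l1(6) l2(6) l3(5) p n' by auto
    qed
    have "y2 = y"
      using l2(3) per_y unfolding sum by (simp add: has_smallest_period_def)
    note l2y = l2(2)[unfolded this]
    have "y < Y" "y1 < Y" using low'[of 0] low'[of "2 * l1 + 3"] l1(3) by simp_all
    have "l1 = n \<and> l2 = n' \<or> l1 = n' \<and> l2 = n \<or> l1 = l2"
      using l1(6) l2(6) sum p n' by arith
    then consider "l1 = n" "l2 = n'" | "l1 = n'" "l2 = n" | "l1 = l2" by blast
    then show False
    proof cases
      case 1
      then show False
        using gap_cycle_unique[OF l1(2) l2y Y[folded 1] Y'[folded 1]] \<open>y < Y\<close> by simp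
    next
      case 2
      then show False
        using gap_cycle_unique[OF l2y l1(2) Y[folded 2] Y'[folded 2]] \<open>y1 < Y\<close> by simp
    next
      case 3
      note l1y = l2y[folded this]
      have "y = y1" by (rule gap_cycle_unique[OF l1(2) l1y l1y l1(2)]) simp
      then have "(T ^^ (2 * l1 + 3)) (rho - y) = rho - y" using l1(3) by simp
      then show False
        using per_y sum by (simp add: has_smallest_period_def)
    qed
  qed
qed

section \<open>The exceptional periods\<close>

text \<open>Odd gaps of length at least 3 never add up to 4, and they add up to 6 only as 3 + 3, which
  repeats the cycle of period 3.\<close>

lemma ex_below_rho_cube:
  assumes per: "has_smallest_period phi p x" and p: "p = 4 \<or> p = 6"
  obtains n where "(T ^^ n) x < rho ^ 3"
proof (rule ccontr)
  assume "\<not> thesis"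
  then have hx: "rho ^ 3 \<le> (T ^^ n) x" for n using that by (meson not_le)
  obtain m y where y: "(T ^^ m) x = rho - y" "rho ^ 3 < y" "y \<le> rho ^ 2"
    and per_y: "has_smallest_period phi p (rho - y)" and lt: "(T ^^ p) (rho - y) < rho ^ 2"
    using start_001_of_period[OF per hx] by blast
  have high: "rho ^ 3 \<le> (T ^^ k) (rho - y)" for k
    using hx[of "k + m"] y(1) by (simp add: funpow_add)
  obtain l1 y1 where l1: "0 + (2 * l1 + 3) \<le> p" "y = rho ^ 3 + rho ^ (2 * l1 + 3) * y1"
    "(T ^^ (0 + (2 * l1 + 3))) (rho - y) = rho - y1" "rho ^ 3 < y1" "y1 \<le> rho ^ 2"
    by (rule next_start_001[OF high lt, of 0 y]) (use y p in auto)
  have "0 + (2 * l1 + 3) < p" using l1(1) p by presburger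
  then obtain l2 y2 where l2: "0 + (2 * l1 + 3) + (2 * l2 + 3) \<le> p"
    "y1 = rho ^ 3 + rho ^ (2 * l2 + 3) * y2"
    "(T ^^ (0 + (2 * l1 + 3) + (2 * l2 + 3))) (rho - y) = rho - y2"
    by (rule next_start_001[OF high lt _ l1(3-5)])
  have "p = 6" "l1 = 0" "l2 = 0" using l2(1) p by auto
  then have "y2 = y" using l2(3) per_y by (simp add: has_smallest_period_def)
  note y1y = l2(2)[unfolded this \<open>l2 = 0\<close>] and yy1 = l1(2)[unfolded \<open>l1 = 0\<close>]
  have "y = y1" by (rule gap_cycle_unique[OF yy1 y1y y1y yy1]) simp
  then show False
    using l1(3) per_y \<open>p = 6\<close> \<open>l1 = 0\<close> by (simp add: has_smallest_period_def)
qed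

lemma S_one_eq: "S_beta phi 1 = 0"
proof (rule S_beta_eqI)
  fix x assume x: "has_smallest_period phi 1 x"
  then have "x \<in> {0..<1}" "T x = x" by (auto simp: has_smallest_period_def)
  then have "x = 0"
    using rho_bounds by (cases rule: T_digit) (auto simp: algebra_simps rho_mult_self)
  then show "\<exists>n. (T ^^ n) x \<le> 0" by (intro exI[of _ 0]) simp
qed (auto simp: beta_map_def)

text \<open>The words 00, 01 and 10 would have to repeat with the values 0, \<open>rho\<close> and 1: a fixed point, a
  point whose first digit is 1, and a point outside \<open>[0, 1)\<close>.\<close>

lemma S_two_eq: "S_beta phi 2 = 0"
proof -
  have "\<not> has_smallest_period phi 2 x" for x
  proof
    assume x: "has_smallest_period phi 2 x"
    define z where "z = T x"
    have x': "x \<in> {0..<1}" "T z = x" "z \<noteq> x"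
      using x by (auto simp: has_smallest_period_def z_def numeral_2_eq_2)
    have z': "z \<in> {0..<1}"
      using beta_map_funpow_range[OF x'(1), of 1 phi] by (simp add: z_def)
    show False
      using x'(1)
    proof (cases rule: T_digit)
      case 1
      then have x1: "x = rho * z" by (simp add: z_def)
      from z' show False
      proof (cases rule: T_digit)
        case 1
        then have "x = rho * (rho * x)" using x1 x'(2) by simp
        then have "x = 0" using rho_bounds by (simp add: rho_mult_self)
        then show False using x1 x'(3) rho_bounds by simp
      next
        case 2
        then have "x = rho * (rho * (1 + x))" using x1 x'(2) by simp
        then have "rho * x = rho * rho"
          by (simp only: rho_mult_self) (simp add: algebra_simps)
        then show False using \<open>x < rho\<close> rho_bounds by simp
      qed
    next
      case 2
      then have x1: "x = rho * (1 + z)" and "z < rho" by (simp_all add: z_def)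
      then have "z = rho * x" using x'(2) T_digit[OF z'] by (metis not_le)
      then have "x = rho + rho * (rho * x)" using x1 by (simp add: algebra_simps)
      then have "rho * x = rho" by (simp add: rho_mult_self)
      then show False using x'(1) rho_bounds by simp
    qed
  qed
  then show ?thesis
    by (auto simp: S_beta_def period_thresholds_def)
qed

text \<open>For the periods 4 and 6 a point below \<open>rho ^ 3\<close> cannot be avoided, so some point begins
  with 000. What remains is to bound it by making its other digits as large as possible.\<close>

lemma prefix_000:
  assumes z: "z \<in> {0..<1}" "z < rho ^ 3"
  shows "z = rho ^ 3 * (T ^^ 3) z"
proof -
  have shrink: "u = rho * T u \<and> T u < rho ^ n" if "u \<in> {0..<1}" "u < rho ^ Suc n" for u n
  proof -
    have "rho ^ Suc n \<le> rho"
      using rho_bounds power_decreasing[of 1 "Suc n" rho] by simp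
    then have u: "u = rho * T u" using that(2) by (cases rule: T_digit[OF that(1)]) auto
    then have "rho * T u < rho * rho ^ n" using that(2) by simp
    then have "T u < rho ^ n" using rho_bounds by simp
    with u show ?thesis ..
  qed
  have "T z \<in> {0..<1}" "T (T z) \<in> {0..<1}"
    using beta_map_funpow_range[OF z(1), of 1 phi] beta_map_funpow_range[OF z(1), of 2 phi]
    by (simp_all add: numeral_2_eq_2)
  with shrink[of z 2] shrink[of "T z" 1] shrink[of "T (T z)" 0] z
  have "z = rho * T z" "T z = rho * T (T z)" "T (T z) = rho * T (T (T z))"
    by (simp_all add: eval_nat_numeral)
  then have "z = rho * (rho * (rho * T (T (T z))))" by metis
  then show ?thesis by (simp add: eval_nat_numeral)
qed

lemma rho_power4: "rho ^ 4 = 2 - 3 * rho" and rho_power6: "rho ^ 6 = 5 - 8 * rho"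
proof -
  have "rho ^ 4 = rho * rho ^ 3" "rho ^ 6 = rho ^ 3 * rho ^ 3"
    by (simp_all flip: power_Suc power_add)
  then show "rho ^ 4 = 2 - 3 * rho" "rho ^ 6 = 5 - 8 * rho"
    by (simp_all add: rho_cube algebra_simps rho_mult_self)
qed

text \<open>The next two lemmas follow the map along an expansion that is written from its end, one digit
  in front of the value \<open>w\<close> of the remaining digits at a time.\<close>

lemma prefix_1:
  assumes "0 < w" "w < rho"
  shows "T (rho * (1 + w)) = w" "0 < rho * (1 + w)" "rho * (1 + w) < 1" "w < rho * (1 + w)"
proof -
  have "rho * 1 < rho * (1 + w)" "rho * (1 + w) < rho * phi"
    using assms rho_bounds by (auto simp: phi_eq)
  moreover from this have "w < rho * (1 + w)" using assms by linarith
  ultimately show "0 < rho * (1 + w)" "rho * (1 + w) < 1" "w < rho * (1 + w)"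
    "T (rho * (1 + w)) = w"
    using rho_phi rho_bounds assms T_above[of "rho * (1 + w)"]
    by (simp_all flip: mult.assoc add: mult.commute[of phi rho])
qed

lemma prefix_0:
  assumes "0 < w" "w < 1"
  shows "T (rho * w) = w" "0 < rho * w" "rho * w < rho" "rho * w < w" "rho * w < 1"
proof -
  show *: "0 < rho * w" "rho * w < rho" "rho * w < w"
    using assms rho_bounds by auto
  then show "T (rho * w) = w" "rho * w < 1"
    using T_below[of "rho * w"] rho_phi rho_bounds
    by (simp_all flip: mult.assoc add: mult.commute[of phi rho])
qed

lemma S_four_eq:
  assumes V: "V = rho ^ 4 * (1 + V)"
  shows "S_beta phi 4 = V"
proof (rule S_beta_eqI)
  have eq: "V = (2 - 3 * rho) + (2 - 3 * rho) * V"
    using V by (simp add: rho_power4 algebra_simps)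
  have "0 < (1 - (2 - 3 * rho)) * V" using eq rho_bounds by (simp add: algebra_simps)
  then have V0: "0 < V" using rho_bounds by (simp add: zero_less_mult_iff)
  then have "(2 - 3 * rho) * V \<le> 1 / 5 * V" using rho_bounds by (intro mult_right_mono) auto
  then have V1: "V < rho" using eq rho_bounds by linarith
  define u3 where "u3 = rho * (1 + V)"
  define u2 where "u2 = rho * u3"
  define u1 where "u1 = rho * u2"
  have Vu: "V = rho * u1"
    unfolding u1_def u2_def u3_def by (subst V) (simp add: eval_nat_numeral)
  note u3 = prefix_1[OF V0 V1, folded u3_def]
  note u2 = prefix_0[OF u3(2,3), folded u2_def]
  note u1 = prefix_0[OF u2(2,5), folded u1_def]
  note u0 = prefix_0[OF u1(2,5), folded Vu]
  show "V \<in> {0..<1}" using u0 by simp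
  show "(T ^^ 4) V = V" using u0 u1 u2 u3 by (simp add: eval_nat_numeral)
  show "V < (T ^^ j) V" if "1 \<le> j" "j < 4" for j
  proof -
    have "j = 1 \<or> j = 2 \<or> j = 3" using that by auto
    then show ?thesis using u0 u1 u2 u3 by (auto simp: eval_nat_numeral)
  qed
  fix x assume per: "has_smallest_period phi 4 x"
  then obtain n where n: "(T ^^ n) x < rho ^ 3" using ex_below_rho_cube by blast
  define z where "z = (T ^^ n) x"
  have z: "z \<in> {0..<1}" "(T ^^ 4) z = z" "z < rho ^ 3"
    using has_smallest_period_funpow[OF per, of n] n by (auto simp: has_smallest_period_def z_def)
  have "T ((T ^^ 3) z) = z" using z(2) by (simp add: eval_nat_numeral)
  then have "(T ^^ 3) z \<le> rho * (1 + z)"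
    using T_digit_le[OF beta_map_funpow_range[OF z(1), of 3 phi]] by simp
  then have "z \<le> rho ^ 3 * (rho * (1 + z))"
    using rho_bounds by (subst prefix_000[OF z(1,3)]) (intro mult_left_mono, auto)
  also have "\<dots> = (2 - 3 * rho) + (2 - 3 * rho) * z"
    by (simp add: rho_cube algebra_simps rho_mult_self)
  finally have "(1 - (2 - 3 * rho)) * z \<le> (1 - (2 - 3 * rho)) * V"
    using eq by (simp add: algebra_simps)
  then have "z \<le> V" using rho_bounds by simp
  then show "\<exists>n. (T ^^ n) x \<le> V" unfolding z_def ..
qed simp

lemma S_six_eq:
  assumes V: "V = rho ^ 4 * (1 + rho ^ 2 * (1 + V))"
  shows "S_beta phi 6 = V"
proof (rule S_beta_eqI)
  have eq: "V = (7 - 11 * rho) + (5 - 8 * rho) * V"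
  proof -
    have "V = rho ^ 4 + rho ^ 6 * (1 + V)"
      by (subst V) (simp add: eval_nat_numeral algebra_simps)
    then show ?thesis by (simp add: rho_power4 rho_power6 algebra_simps)
  qed
  have "0 < (1 - (5 - 8 * rho)) * V" using eq rho_bounds by (simp add: algebra_simps)
  then have V0: "0 < V" using rho_bounds by (simp add: zero_less_mult_iff)
  then have "(5 - 8 * rho) * V \<le> 1 / 10 * V" using rho_bounds by (intro mult_right_mono) auto
  then have V2: "V < rho ^ 2" and V1: "V < rho" using eq rho_bounds rho_square by linarith+
  define u5 where "u5 = rho * (1 + V)"
  define u4 where "u4 = rho * u5"
  define u3 where "u3 = rho * (1 + u4)"
  define u2 where "u2 = rho * u3"
  define u1 where "u1 = rho * u2"
  have Vu: "V = rho * u1"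
    unfolding u1_def u2_def u3_def u4_def u5_def by (subst V) (simp add: eval_nat_numeral)
  note u5 = prefix_1[OF V0 V1, folded u5_def]
  note u4 = prefix_0[OF u5(2,3), folded u4_def]
  note u3 = prefix_1[OF u4(2,3), folded u3_def]
  note u2 = prefix_0[OF u3(2,3), folded u2_def]
  note u1 = prefix_0[OF u2(2,5), folded u1_def]
  note u0 = prefix_0[OF u1(2,5), folded Vu]
  have "u4 = rho ^ 2 + rho ^ 2 * V"
    by (simp add: u4_def u5_def power2_eq_square algebra_simps)
  then have Vu4: "V < u4" using V2 V0 rho_bounds by (simp add: add_strict_increasing2 less_le_trans)
  show "V \<in> {0..<1}" using u0 by simp
  show "(T ^^ 6) V = V" using u0 u1 u2 u3 u4 u5 by (simp add: eval_nat_numeral)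
  show "V < (T ^^ j) V" if "1 \<le> j" "j < 6" for j
  proof -
    have "j = 1 \<or> j = 2 \<or> j = 3 \<or> j = 4 \<or> j = 5" using that by auto
    then show ?thesis using u0 u1 u2 u3 u4 u5 Vu4 by (auto simp: eval_nat_numeral)
  qed
  fix x assume per: "has_smallest_period phi 6 x"
  then obtain n where n: "(T ^^ n) x < rho ^ 3" using ex_below_rho_cube by blast
  define z where "z = (T ^^ n) x"
  have z: "z \<in> {0..<1}" "(T ^^ 6) z = z" "z < rho ^ 3"
    using has_smallest_period_funpow[OF per, of n] n by (auto simp: has_smallest_period_def z_def)
  define w where "w = (T ^^ 3) z"
  have w: "w \<in> {0..<1}" "T w \<in> {0..<1}" "T (T w) \<in> {0..<1}"
    using beta_map_funpow_range[OF z(1), of 3 phi] beta_map_funpow_range[OF z(1), of 4 phi]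
      beta_map_funpow_range[OF z(1), of 5 phi]
    by (simp_all add: w_def eval_nat_numeral)
  have Tw: "T (T (T w)) = z" using z(2) by (simp add: w_def eval_nat_numeral)
  \<comment> \<open>Among the words of length 3 without 11, the greatest is 101.\<close>
  have "w \<le> rho * (1 + rho * (rho * (1 + z)))"
    using w(1)
  proof (cases rule: T_digit)
    case 1
    have "T (T w) \<le> rho * (1 + z)" using T_digit_le[OF w(3)] Tw by simp
    then have "rho * T (T w) \<le> rho * (rho * (1 + z))" using rho_bounds by simp
    then have "T w \<le> rho + rho * (rho * (1 + z))"
      using T_digit_le[OF w(2)] by (simp add: algebra_simps)
    then have "rho * T w \<le> rho * (1 + rho * (rho * (1 + z)))"
      using rho_bounds by (intro mult_left_mono) linarith+
    then show ?thesis using 1 by simp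
  next
    case 2
    then have "T w = rho * T (T w)" using T_digit[OF w(2)] by (metis not_le)
    also have "\<dots> \<le> rho * (rho * (1 + z))"
      using T_digit_le[OF w(3)] Tw rho_bounds by simp
    finally have "1 + T w \<le> 1 + rho * (rho * (1 + z))" by simp
    then have "rho * (1 + T w) \<le> rho * (1 + rho * (rho * (1 + z)))"
      using rho_bounds by (intro mult_left_mono) auto
    then show ?thesis using 2(2) by simp
  qed
  then have "z \<le> rho ^ 3 * (rho * (1 + rho * (rho * (1 + z))))"
    using rho_bounds by (subst prefix_000[OF z(1,3)]) (intro mult_left_mono, auto simp: w_def)
  also have "\<dots> = rho ^ 4 + rho ^ 6 + rho ^ 6 * z"
    by (simp add: eval_nat_numeral algebra_simps)
  finally have "(1 - (5 - 8 * rho)) * z \<le> (1 - (5 - 8 * rho)) * V"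
    using eq by (simp add: rho_power4 rho_power6 algebra_simps)
  then have "z \<le> V" using rho_bounds by simp
  then show "\<exists>n. (T ^^ n) x \<le> V" unfolding z_def ..
qed simp

section \<open>Values of periodic expansions\<close>

lemma beta_value_Cons:
  assumes \<beta>: "\<beta> > 1" and bdd: "\<And>i. s !! i \<le> B"
  shows "beta_value \<beta> (d ## s) = (real d + beta_value \<beta> s) / \<beta>"
proof -
  let ?f = "\<lambda>i. real (s !! i) / \<beta> ^ (i + 1)"
  let ?g = "\<lambda>i. real ((d ## s) !! i) / \<beta> ^ (i + 1)"
  have "summable (\<lambda>i. (1 / \<beta>) ^ i)"
    using \<beta> by (intro summable_geometric) auto
  then have "summable (\<lambda>i. real B / \<beta> * (1 / \<beta>) ^ i)"
    by (rule summable_mult)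
  moreover have "norm (?f i) \<le> real B / \<beta> * (1 / \<beta>) ^ i" for i
    using \<beta> bdd[of i] by (simp add: power_one_over divide_right_mono)
  ultimately have sm: "summable ?f"
    by (rule summable_comparison_test'[where N = 0])
  have shift: "?g (Suc i) = ?f i / \<beta>" for i
    by simp
  have "summable (\<lambda>i. ?g (Suc i))"
    unfolding shift using sm by (rule summable_divide)
  then have "summable ?g"
    by (subst (asm) summable_Suc_iff)
  then have "suminf ?g = ?g 0 + (\<Sum>i. ?g (Suc i))"
    by (subst suminf_split_head) auto
  also have "(\<Sum>i. ?g (Suc i)) = beta_value \<beta> s / \<beta>"
    unfolding shift beta_value_def using sm by (rule suminf_divide)
  finally show ?thesis
    by (simp add: beta_value_def add_divide_distrib)
qed

lemma beta_value_phi_Cons: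
  assumes "sset s \<subseteq> {0, 1}"
  shows "beta_value phi (d ## s) = rho * (real d + beta_value phi s)"
proof -
  have "s !! i \<le> 1" for i
  proof -
    have "s !! i \<in> {0, 1}" using assms snth_sset by blast
    then show ?thesis by auto
  qed
  moreover have "phi > 1" using rho_bounds by (simp add: phi_eq)
  ultimately have "beta_value phi (d ## s) = (real d + beta_value phi s) / phi"
    by (intro beta_value_Cons)
  then show ?thesis
    using rho_phi \<open>phi > 1\<close> by (simp add: divide_eq_eq)
qed

lemma set_word_power: "set (word_power w k) \<subseteq> set w"
  by (auto simp: word_power_def)

lemma beta_value_run_01:
  assumes "sset s \<subseteq> {0, 1}"
  shows "rho - beta_value phi (word_power [0, 1] n @- s) = rho ^ (2 * n) * (rho - beta_value phi s)"
proof (induction n)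
  case 0
  then show ?case by (simp add: word_power_def)
next
  case (Suc n)
  let ?s = "word_power [0, 1] n @- s"
  have s: "sset ?s \<subseteq> {0, 1}"
    using assms set_word_power[of "[0, 1 :: nat]" n] by auto
  have "word_power [0, 1] (Suc n) @- s = 0 ## 1 ## ?s"
    by (simp add: word_power_def)
  moreover have "rho - rho * (rho * (1 + v)) = rho ^ 2 * (rho - v)" for v
    by (simp add: power2_eq_square algebra_simps rho_mult_self)
  ultimately have "rho - beta_value phi (word_power [0, 1] (Suc n) @- s) =
      rho ^ 2 * (rho - beta_value phi ?s)"
    using s by (simp add: beta_value_phi_Cons)
  then show ?case
    by (simp only: Suc) (simp add: power2_eq_square)
qed

text \<open>This is the relation of \<open>return_001\<close> between consecutive distances. Unrolled once around
  a cycle, it gives the equations that determine the optimal minima in \<open>S_one_gap\<close> and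
  \<open>S_two_gaps\<close>.\<close>

lemma beta_value_gap:
  assumes "sset s \<subseteq> {0, 1}"
  shows "rho - beta_value phi ([0, 0, 1] @- word_power [0, 1] n @- s) =
    rho ^ 3 + rho ^ (2 * n + 3) * (rho - beta_value phi s)"
proof -
  let ?s = "word_power [0, 1] n @- s"
  have s: "sset ?s \<subseteq> {0, 1}"
    using assms set_word_power[of "[0, 1 :: nat]" n] by auto
  have "rho - rho * (rho * (rho * (1 + v))) = rho ^ 3 + rho ^ 3 * (rho - v)" for v
    by (simp add: power3_eq_cube algebra_simps rho_mult_self)
  then have "rho - beta_value phi ([0, 0, 1] @- ?s) = rho ^ 3 + rho ^ 3 * (rho - beta_value phi ?s)"
    using s by (simp add: beta_value_phi_Cons)
  then show ?thesis
    by (simp only: beta_value_run_01[OF assms]) (simp add: power_add)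
qed

lemma S_odd:
  "S_beta phi (2 * m + 1) = beta_value phi (cycle ([0] @ word_power [0, 1] m))"
proof (cases m)
  case 0
  have "beta_value phi (cycle [0]) = beta_value phi (0 ## cycle [0])"
    by (rule arg_cong, rule cycle_Cons[of _ "[]", unfolded append_Nil])
  also have "\<dots> = rho * beta_value phi (cycle [0])"
    by (simp add: beta_value_phi_Cons)
  finally have "(1 - rho) * beta_value phi (cycle [0]) = 0"
    by (simp add: left_diff_distrib)
  then have "beta_value phi (cycle [0]) = 0" using rho_bounds by simp
  then show ?thesis using S_one_eq 0 by (simp add: word_power_def)
next
  case (Suc n)
  let ?w = "[0] @ word_power [0, 1] m :: nat list"
  have w: "?w = [0, 0, 1] @ word_power [0, 1] n"
    unfolding Suc by (simp add: word_power_def)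
  have split: "?w @- s = [0, 0, 1] @- word_power [0, 1] n @- s" for s
    unfolding w by simp
  have bits: "sset (cycle ?w) \<subseteq> {0, 1}"
    using set_word_power[of "[0, 1 :: nat]" m] by auto
  have "cycle ?w = ?w @- cycle ?w" by (rule cycle_decomp) simp
  also have "\<dots> = [0, 0, 1] @- word_power [0, 1] n @- cycle ?w"
    by (rule split)
  finally have w_eq: "cycle ?w = \<dots>" .
  have "rho - beta_value phi (cycle ?w) =
      rho ^ 3 + rho ^ (2 * n + 3) * (rho - beta_value phi (cycle ?w))"
    using beta_value_gap[OF bits, of n] unfolding w_eq[symmetric] .
  from S_one_gap[OF this] have "S_beta phi (2 * n + 3) = beta_value phi (cycle ?w)" by simp
  moreover have eq: "2 * m + 1 = 2 * n + 3" using Suc by simp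
  ultimately show ?thesis by (subst eq)
qed

lemma S_even:
  assumes n': "n' = n + 1 \<or> n' = n + 2"
  shows "S_beta phi ((2 * n + 3) + (2 * n' + 3)) =
    beta_value phi (cycle ([0, 0, 1] @ word_power [0, 1] n @ [0, 0, 1] @ word_power [0, 1] n'))"
    (is "_ = beta_value phi (cycle ?w)")
proof -
  let ?s = "[0, 0, 1] @- word_power [0, 1] n' @- cycle ?w"
  have bits: "sset (cycle ?w) \<subseteq> {0, 1}"
    using set_word_power[of "[0, 1 :: nat]" n] set_word_power[of "[0, 1 :: nat]" n'] by auto
  have bits': "sset ?s \<subseteq> {0, 1}"
    using bits set_word_power[of "[0, 1 :: nat]" n'] by auto
  have "cycle ?w = ?w @- cycle ?w" by (rule cycle_decomp) simp
  also have "\<dots> = [0, 0, 1] @- word_power [0, 1] n @- ?s" by simp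
  finally have w_eq: "cycle ?w = \<dots>" .
  have "rho - beta_value phi (cycle ?w) =
      rho ^ 3 + rho ^ (2 * n + 3) * (rho - beta_value phi ?s)"
    using beta_value_gap[OF bits', of n] unfolding w_eq[symmetric] .
  from S_two_gaps[OF this beta_value_gap[OF bits] n' refl] show ?thesis
    by simp
qed

lemma S_four: "S_beta phi 4 = beta_value phi (cycle [0, 0, 0, 1])"
proof (rule S_four_eq)
  have "cycle [0, 0, 0, 1 :: nat] = [0, 0, 0, 1] @- cycle [0, 0, 0, 1]"
    by (rule cycle_decomp) simp
  also have "\<dots> = 0 ## 0 ## 0 ## 1 ## cycle [0, 0, 0, 1]" by simp
  finally have "beta_value phi (cycle [0, 0, 0, 1]) =
      beta_value phi (0 ## 0 ## 0 ## 1 ## cycle [0, 0, 0, 1])" by (rule arg_cong)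
  then show "beta_value phi (cycle [0, 0, 0, 1]) =
      rho ^ 4 * (1 + beta_value phi (cycle [0, 0, 0, 1]))"
    by (simp add: beta_value_phi_Cons eval_nat_numeral)
qed

lemma S_six: "S_beta phi 6 = beta_value phi (cycle ([0, 0] @ word_power [0, 1] 2))"
proof (rule S_six_eq)
  let ?w = "[0, 0, 0, 1, 0, 1 :: nat]"
  have w: "[0, 0] @ word_power [0, 1] 2 = ?w"
    by (simp add: word_power_def numeral_2_eq_2)
  have "cycle ?w = ?w @- cycle ?w" by (rule cycle_decomp) simp
  also have "\<dots> = 0 ## 0 ## 0 ## 1 ## 0 ## 1 ## cycle ?w" by simp
  finally have "beta_value phi (cycle ?w) =
      beta_value phi (0 ## 0 ## 0 ## 1 ## 0 ## 1 ## cycle ?w)" by (rule arg_cong)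
  also have "\<dots> = rho * (rho * (rho * (rho * (1 + rho * (rho * (1 + beta_value phi (cycle ?w)))))))"
    by (simp add: beta_value_phi_Cons)
  also have "\<dots> = rho ^ 4 * (1 + rho ^ 2 * (1 + beta_value phi (cycle ?w)))"
    by (simp add: eval_nat_numeral mult.assoc)
  finally show "beta_value phi (cycle ([0, 0] @ word_power [0, 1] 2)) = rho ^ 4 *
      (1 + rho ^ 2 * (1 + beta_value phi (cycle ([0, 0] @ word_power [0, 1] 2))))"
    unfolding w .
qed

theorem theorem4p3:
  fixes \<beta> :: real
  assumes "\<beta> = (1 + sqrt 5) / 2"
  shows "S_beta \<beta> 2 = 0 \<and>
    S_beta \<beta> 4 = beta_value \<beta> (cycle [0, 0, 0, 1]) \<and>
    S_beta \<beta> 6 = beta_value \<beta> (cycle ([0, 0] @ word_power [0, 1] 2)) \<and>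
    (\<forall>m::nat. S_beta \<beta> (2 * m + 1) = beta_value \<beta> (cycle ([0] @ word_power [0, 1] m))) \<and>
    (\<forall>m::nat. m \<ge> 2 \<longrightarrow>
       S_beta \<beta> (4 * m + 2) =
         beta_value \<beta> (cycle ([0, 0, 1] @ word_power [0, 1] (m - 2) @
                              [0, 0, 1] @ word_power [0, 1] m))) \<and>
    (\<forall>m::nat. m \<ge> 1 \<longrightarrow>
       S_beta \<beta> (4 * m + 4) =
         beta_value \<beta> (cycle ([0, 0, 1] @ word_power [0, 1] (m - 1) @
                              [0, 0, 1] @ word_power [0, 1] m)))"
proof -
  have \<beta>: "\<beta> = phi" using assms by (simp add: phi_def)
  have "S_beta phi (4 * m + 2) =
      beta_value phi (cycle ([0, 0, 1] @ word_power [0, 1] (m - 2) @ [0, 0, 1] @ word_power [0, 1] m))"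
    if m: "m \<ge> 2" for m
  proof -
    have eq: "4 * m + 2 = (2 * (m - 2) + 3) + (2 * m + 3)" using m by simp
    show ?thesis by (subst eq, rule S_even) (use m in auto)
  qed
  moreover have "S_beta phi (4 * m + 4) =
      beta_value phi (cycle ([0, 0, 1] @ word_power [0, 1] (m - 1) @ [0, 0, 1] @ word_power [0, 1] m))"
    if m: "m \<ge> 1" for m
  proof -
    have eq: "4 * m + 4 = (2 * (m - 1) + 3) + (2 * m + 3)" using m by simp
    show ?thesis by (subst eq, rule S_even) (use m in auto)
  qed
  ultimately show ?thesis
    unfolding \<beta> using S_two_eq S_four S_six S_odd by blast
qed

end
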